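(* Let $f$ be a sufficiently smooth real-valued function and let $u$ be the exact solution of $u'=f(t,u)$ near a fixed time $t$. For real coefficients $a_{21},a_{31},a_{32},b_1,b_2,b_3,c_2,c_3$ and real numbers $\epsilon_2^2,\epsilon_3^2$ (not depending on $h$), let $\tau(h)$ be the local truncation error at $t$ of the three-stage RBF Runge-Kutta method (defined in the context). Write $u=u(t)$, $u''=u''(t)=f_t+f_uf$, with $f$ and all its partial derivatives evaluated at $(t,u(t))$. (i) If $b_1+b_2+b_3=1$, $a_{21}=c_2$, $a_{31}+a_{32}=c_3$, $b_2c_2+b_3c_3=\frac12$, $b_2c_2^2+b_3c_3^2=\frac13$, $a_{32}b_3c_2=\frac16$ and $b_2c_2^2\epsilon_2^2+b_3c_3^2\epsilon_3^2=0$, then $\tau(h)=O(h^3)$ as $h\to0$ (the method has order at least $3$). (ii) In each of the following cases, provided the denominator in the displayed expression for $\epsilon_2^2$ is nonzero, $\tau(h)=O(h^4)$ as $h\to0$ (the method is fourth-order accurate): Case I: $a_{21}=c_2=\frac12$, $a_{31}=-1$, $a_{32}=2$, $c_3=1$, $b_1=\frac16$, $b_2=\frac23$, $b_3=\frac16$, and $$\epsilon_2^2=-\frac{u''}{2u},\qquad \epsilon_3^2=-\epsilon_2^2.$$ Case II(a): $a_{21}=c_2=\frac{15-\sqrt{33}}{24}$, $a_{31}=-\frac{147+29\sqrt{33}}{768}$, $a_{32}=\frac{627+61\sqrt{33}}{768}$, $c_3=\frac{15+\sqrt{33}}{24}$, $b_1=\frac18$, $b_2=\frac{77+3\sqrt{33}}{176}$,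 $b_3=\frac{77-3\sqrt{33}}{176}$, and $$\epsilon_2^2=\frac{-2(3-\sqrt{33})(f_{tu}+f_{uu}f)f_t+(3-\sqrt{33})(f_{tt}-f_{uu}f^2)f_u-12f_u^2u''}{2\left[2(3-\sqrt{33})(f_{tu}+f_{uu}f)+(15-\sqrt{33})f_u^2\right]u},\qquad \epsilon_3^2=-\frac{7-\sqrt{33}}{4}\epsilon_2^2.$$ Case II(b): $a_{21}=c_2=\frac{15+\sqrt{33}}{24}$, $a_{31}=\frac{-147+29\sqrt{33}}{768}$, $a_{32}=\frac{627-61\sqrt{33}}{768}$, $c_3=\frac{15-\sqrt{33}}{24}$, $b_1=\frac18$, $b_2=\frac{77-3\sqrt{33}}{176}$, $b_3=\frac{77+3\sqrt{33}}{176}$, and $$\epsilon_2^2=\frac{-2(3+\sqrt{33})(f_{tu}+f_{uu}f)f_t+(3+\sqrt{33})(f_{tt}-f_{uu}f^2)f_u-12f_u^2u''}{2\left[2(3+\sqrt{33})(f_{tu}+f_{uu}f)+(15+\sqrt{33})f_u^2\right]u},\qquad \epsilon_3^2=-\frac{7+\sqrt{33}}{4}\epsilon_2^2.$$ Case III(a): $a_{21}=c_2=\frac13$, $a_{31}=-\frac5{12}$, $a_{32}=\frac54$, $c_3=\frac56$, $b_1=\frac1{10}$, $b_2=\frac12$, $b_3=\frac25$, and $$\epsilon_2^2=\frac{(f_{tu}+f_{uu}f)f_t-(f_{tt}+f_{tu}f)f_u-3f_u^2u''}{2(2f_u^2-f_{tu}-f_{uu}f)u},\qquad \epsilon_3^2=-\frac15\epsilon_2^2.$$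 Case III(b): $a_{21}=c_2=1$, $a_{31}=\frac14$, $a_{32}=\frac14$, $c_3=\frac12$, $b_1=\frac16$, $b_2=\frac16$, $b_3=\frac23$, and $$\epsilon_2^2=\frac{-(f_{tu}+f_{uu}f)f_t+(f_{tt}+f_{tu}f)f_u-f_u^2u''}{2(2f_u^2+f_{tu}+f_{uu}f)u},\qquad \epsilon_3^2=-\epsilon_2^2.$$ Case IV: $a_{21}=c_2=\frac12$, $a_{31}=0$, $a_{32}=c_3=\frac34$, $b_1=\frac29$, $b_2=\frac13$, $b_3=\frac49$, and $$\epsilon_2^2=-\frac{f_{ttt}+f_{uuu}f^3+3(f_{ttu}+f_{tuu}f)f+12f_u^2u''}{6(4f_u^2-f_{tu}-f_{uu}f)u},\qquad \epsilon_3^2=-\frac13\epsilon_2^2.$$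
   Context: The three-stage RBF Runge-Kutta method with step $h$ and squared shape parameters $\epsilon_2^2,\epsilon_3^2\in\mathbb R$ (shape parameters are real or purely imaginary, so their squares are real of either sign) maps the value $v$ at time $t$ to $v+h(b_1k_1+b_2k_2+b_3k_3)$, where $$k_1=f(t,v),\quad k_2=f\big(t+c_2h,\;v\,e^{-\epsilon_2^2(c_2h)^2}+h\,a_{21}k_1\big),\quad k_3=f\big(t+c_3h,\;v\,e^{-\epsilon_3^2(c_3h)^2}+h(a_{31}k_1+a_{32}k_2)\big).$$ Its local truncation error at $t$ is the error of a single step started from the exact value, divided by $h$: $$\tau(h)=\frac{u(t+h)-u(t)}{h}-(b_1k_1+b_2k_2+b_3k_3)\quad\text{with } v=u(t).$$ The method is said to have order $p$ when $\tau(h)=O(h^p)$. Subscripts $t,u$ on $f$ denote partial derivatives. *)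

theory Defs
  imports "HOL-Analysis.Analysis" "HOL-Library.Landau_Symbols"
begin

definition pd_t :: "(real \<Rightarrow> real \<Rightarrow> real) \<Rightarrow> real \<Rightarrow> real \<Rightarrow> real" where
  "pd_t f t u = deriv (\<lambda>s. f s u) t"

definition pd_u :: "(real \<Rightarrow> real \<Rightarrow> real) \<Rightarrow> real \<Rightarrow> real \<Rightarrow> real" where
  "pd_u f t u = deriv (\<lambda>w. f t w) u"

(* "f is of class C^n on S", for S open: all iterated partial derivatives of order
   at most n exist and are continuous on S. *)
primrec Ck_on :: "nat \<Rightarrow> (real \<Rightarrow> real \<Rightarrow> real) \<Rightarrow> (real \<times> real) set \<Rightarrow> bool" where
  "Ck_on 0 f S \<longleftrightarrow> continuous_on S (\<lambda>(t, u). f t u)"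
| "Ck_on (Suc n) f S \<longleftrightarrow>
     continuous_on S (\<lambda>(t, u). f t u) \<and>
     (\<forall>(t, u) \<in> S. (\<lambda>s. f s u) differentiable (at t) \<and> (\<lambda>w. f t w) differentiable (at u)) \<and>
     Ck_on n (pd_t f) S \<and> Ck_on n (pd_u f) S"

(* The fields eps2sq and eps3sq are the squared shape parameters, which may have either sign. *)
record rbf_rk3 =
  a21 :: real
  a31 :: real
  a32 :: real
  b1 :: real
  b2 :: real
  b3 :: real
  c2 :: real
  c3 :: real
  eps2sq :: real
  eps3sq :: real

definition stage1 :: "(real \<Rightarrow> real \<Rightarrow> real) \<Rightarrow> real \<Rightarrow> real \<Rightarrow> real" where
  "stage1 f t v = f t v"

definition stage2 :: "rbf_rk3 \<Rightarrow> (real \<Rightarrow> real \<Rightarrow> real) \<Rightarrow> real \<Rightarrow> real \<Rightarrow> real \<Rightarrow> real" where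
  "stage2 M f t v h =
     f (t + c2 M * h) (v * exp (- eps2sq M * (c2 M * h)^2) + h * (a21 M * stage1 f t v))"

definition stage3 :: "rbf_rk3 \<Rightarrow> (real \<Rightarrow> real \<Rightarrow> real) \<Rightarrow> real \<Rightarrow> real \<Rightarrow> real \<Rightarrow> real" where
  "stage3 M f t v h =
     f (t + c3 M * h) (v * exp (- eps3sq M * (c3 M * h)^2)
       + h * (a31 M * stage1 f t v + a32 M * stage2 M f t v h))"

definition increment :: "rbf_rk3 \<Rightarrow> (real \<Rightarrow> real \<Rightarrow> real) \<Rightarrow> real \<Rightarrow> real \<Rightarrow> real \<Rightarrow> real" where
  "increment M f t v h =
     b1 M * stage1 f t v + b2 M * stage2 M f t v h + b3 M * stage3 M f t v h"

definition rbf_step :: "rbf_rk3 \<Rightarrow> (real \<Rightarrow> real \<Rightarrow> real) \<Rightarrow> real \<Rightarrow> real \<Rightarrow> real \<Rightarrow> real" where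
  "rbf_step M f t v h = v + h * increment M f t v h"

definition local_truncation_error ::
    "rbf_rk3 \<Rightarrow> (real \<Rightarrow> real \<Rightarrow> real) \<Rightarrow> (real \<Rightarrow> real) \<Rightarrow> real \<Rightarrow> real \<Rightarrow> real" where
  "local_truncation_error M f u t h = (u (t + h) - u t) / h - increment M f t (u t) h"

lemma local_truncation_error_eq_one_step_error:
  assumes "h \<noteq> 0"
  shows "local_truncation_error M f u t h = (u (t + h) - rbf_step M f t (u t) h) / h"
  using assms by (simp add: local_truncation_error_def rbf_step_def field_simps)

(* The method M (with coefficients and shape parameters independent of h) has order p
   at t along the solution u. *)
definition has_order_at ::
    "rbf_rk3 \<Rightarrow> (real \<Rightarrow> real \<Rightarrow> real) \<Rightarrow> (real \<Rightarrow> real) \<Rightarrow> real \<Rightarrow> nat \<Rightarrow> bool" where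
  "has_order_at M f u t p \<longleftrightarrow> (\<lambda>h. local_truncation_error M f u t h) \<in> O[at 0](\<lambda>h. h ^ p)"

end

theory Submission
  imports Defs
begin

text \<open>
  The order of a one-step method is read off by comparing two expansions in powers of \<open>h\<close>: that
  of the solution and that of the stages. Everything rests on a single expansion,
  \<open>expansion_along_curve\<close>: if \<open>y h\<close> agrees with a cubic in \<open>h\<close> up to \<open>O(h^n)\<close>, then
  \<open>f (t + c h) (w + y h)\<close> agrees up to \<open>O(h^n)\<close> with an explicit cubic, whose coefficients
  \<open>coeff1\<close>, \<open>coeff2\<close>, \<open>coeff3\<close> involve only the partial derivatives of \<open>f\<close> at the base point.
  It follows from the two-variable Taylor formula \<open>taylor_bound\<close>.

  The solution is expanded by Picard iteration on jets: inserting an expansion of \<open>u\<close> with error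
  \<open>O(h^n)\<close> into \<open>u' = f(t,u)\<close> and integrating improves the error to \<open>O(h^(n+1))\<close>
  (\<open>picard_step\<close>). The stages are expanded directly, the Gaussian factor contributing
  \<open>- eps^2 (c h)^2 u\<close> at second order and nothing else below order four
  (\<open>shape_factor_bigo\<close>).

  Comparing coefficients, the seven conditions of part (i) cancel the terms of order \<open>0\<close>, \<open>1\<close>
  and \<open>2\<close> in the truncation error, and its \<open>h^3\<close> term is \<open>error_coeff / 24\<close>
  (\<open>truncation_error_expansion\<close>). This coefficient is affine in the squared shape parameters.
  In each case of part (ii) the ratio of the two parameters is fixed so as to satisfy the last of
  the seven conditions, and the displayed value of \<open>eps_2^2\<close> is a zero of the resulting affine
  function.
\<close>

section \<open>Taylor's formula in two variables\<close>

text \<open>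
  The derivatives in \<open>t\<close> are always taken first, which matches the mixed derivatives
  \<open>pd_u (pd_t f)\<close>, \<open>pd_u (pd_t (pd_t f))\<close>, \<open>pd_u (pd_u (pd_t f))\<close> of the theorem. The index \<open>n\<close> is the order of the remainder:
  the polynomial has degree less than \<open>n\<close>.
\<close>
definition taylor_poly ::
    "nat \<Rightarrow> (real \<Rightarrow> real \<Rightarrow> real) \<Rightarrow> real \<Rightarrow> real \<Rightarrow> real \<Rightarrow> real \<Rightarrow> real" where
  "taylor_poly n f t w x y =
     (\<Sum>i<n. \<Sum>j<n - i. (pd_u ^^ j) ((pd_t ^^ i) f) t w * (x ^ i / fact i) * (y ^ j / fact j))"

lemma DERIV_power_div_fact:
  "((\<lambda>x. x ^ Suc i / fact (Suc i)) has_real_derivative x ^ i / fact i) (at x)"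
  using DERIV_cdivide[OF DERIV_pow[of "Suc i" x], of "fact (Suc i)"]
  by (simp add: field_simps del: of_nat_Suc power_Suc)

lemma taylor_poly_zero_Suc:
  "taylor_poly (Suc n) f t w 0 y = (\<Sum>j<Suc n. (pd_u ^^ j) f t w * (y ^ j / fact j))"
  unfolding taylor_poly_def by (subst sum.lessThan_Suc_shift) (simp add: )

lemma DERIV_add_const: "(g has_real_derivative D) (at x) \<Longrightarrow> ((\<lambda>x. c + g x) has_real_derivative D) (at x)"
  using DERIV_add[OF DERIV_const, of g D x UNIV c] by simp

lemma taylor_poly_dx:
  "((\<lambda>x. taylor_poly (Suc n) f t w x y) has_real_derivative taylor_poly n (pd_t f) t w x y) (at x)"
proof -
  have *: "taylor_poly (Suc n) f t w x y = (\<Sum>j<Suc n. (pd_u ^^ j) f t w * (y ^ j / fact j)) +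
     (\<Sum>i<n. \<Sum>j<n - i. (pd_u ^^ j) ((pd_t ^^ i) (pd_t f)) t w * (x ^ Suc i / fact (Suc i)) * (y ^ j / fact j))" for x
    unfolding taylor_poly_def
    by (subst sum.lessThan_Suc_shift) (simp add: funpow_swap1 del: fact_Suc power_Suc sum.lessThan_Suc)
  show ?thesis
    unfolding * unfolding taylor_poly_def
    by (intro DERIV_add_const DERIV_sum DERIV_cmult DERIV_cmult_right DERIV_power_div_fact)
qed

lemma taylor_poly_zero_dy:
  "((\<lambda>y. taylor_poly (Suc n) f t w 0 y) has_real_derivative taylor_poly n (pd_u f) t w 0 y) (at y)"
proof (cases n)
  case 0
  then show ?thesis by (simp add: taylor_poly_def)
next
  case (Suc m)
  have *: "taylor_poly (Suc n) f t w 0 y = f t w +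
     (\<Sum>j<n. (pd_u ^^ j) (pd_u f) t w * (y ^ Suc j / fact (Suc j)))" for y
    unfolding taylor_poly_zero_Suc
    by (subst sum.lessThan_Suc_shift) (simp add: funpow_swap1 del: fact_Suc power_Suc sum.lessThan_Suc)
  show ?thesis
    unfolding * unfolding Suc taylor_poly_zero_Suc
    by (intro DERIV_add_const DERIV_sum DERIV_cmult DERIV_power_div_fact)
qed

text \<open>
  Excluding \<open>s = 0\<close> in the bound lets the lemma be applied to estimates that hold only in a
  punctured neighbourhood, as those expressed by \<open>O[at 0]\<close> do.
\<close>
lemma mvt_bound_from_zero:
  fixes g g' :: "real \<Rightarrow> real"
  assumes "\<And>s. \<bar>s\<bar> \<le> \<bar>x\<bar> \<Longrightarrow> (g has_real_derivative g' s) (at s)"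
    and "\<And>s. \<bar>s\<bar> \<le> \<bar>x\<bar> \<Longrightarrow> s \<noteq> 0 \<Longrightarrow> \<bar>g' s\<bar> \<le> B"
  shows "\<bar>g x - g 0\<bar> \<le> B * \<bar>x\<bar>"
proof -
  consider "x = 0" | "x > 0" | "x < 0" by linarith
  then obtain s where "\<bar>s\<bar> \<le> \<bar>x\<bar>" "x \<noteq> 0 \<Longrightarrow> s \<noteq> 0" "g x - g 0 = x * g' s"
  proof cases
    case 1
    then show ?thesis using that[of 0] by simp
  next
    case 2
    then obtain z where "0 < z" "z < x" "g x - g 0 = (x - 0) * g' z"
      using MVT2[of 0 x g g'] assms(1) by auto
    then show ?thesis using that[of z] by simp
  next
    case 3
    then obtain z where "x < z" "z < 0" "g 0 - g x = (0 - x) * g' z"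
      using MVT2[of x 0 g g'] assms(1) by auto
    then show ?thesis using that[of z] by simp
  qed
  then show ?thesis
    using assms(2)[of s] by (cases "x = 0") (auto simp: abs_mult mult.commute intro: mult_right_mono)
qed

lemma DERIV_shift_left:
  "(g has_real_derivative D) (at (a + x)) \<Longrightarrow> ((\<lambda>x. g (a + x)) has_real_derivative D) (at x)"
  using DERIV_shift[of g D x a] by (simp add: add.commute)

text \<open>
  Induction on \<open>n\<close>. The remainder vanishes at the origin. It is estimated by moving first in the
  second variable along \<open>x = 0\<close> and then in the first variable. On the first segment its
  derivative is the remainder of \<open>pd_u f\<close>, on the second one that of \<open>pd_t f\<close>, so both are
  \<open>O((|x| + |y|)^n)\<close> by the induction hypothesis and the mean value theorem gains one order. The
  two directions are taken in this order because the \<open>y\<close>-derivative of the polynomial is the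
  Taylor polynomial of \<open>pd_u f\<close> by mere reindexing only along \<open>x = 0\<close>, where all terms are pure
  \<open>u\<close>-derivatives.
\<close>
lemma taylor_bound:
  assumes "open S" "(t, w) \<in> S" "Ck_on n f S"
  shows "\<exists>C d. 0 \<le> C \<and> 0 < d \<and> (\<forall>x y. \<bar>x\<bar> < d \<longrightarrow> \<bar>y\<bar> < d \<longrightarrow>
           \<bar>f (t + x) (w + y) - taylor_poly n f t w x y\<bar> \<le> C * (\<bar>x\<bar> + \<bar>y\<bar>) ^ n)"
  using assms(3)
proof (induction n arbitrary: f)
  case 0
  then have "isCont (\<lambda>(t, u). f t u) (t, w)"
    using assms(1,2) by (simp add: continuous_on_eq_continuous_at)
  then have "\<exists>d>0. \<forall>p. dist p (t, w) < d \<longrightarrow> dist (f (fst p) (snd p)) (f t w) < 1"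
    unfolding continuous_at_eps_delta by (drule_tac spec[of _ 1]) (simp add: case_prod_unfold)
  then obtain d where d: "d > 0" "\<And>p. dist p (t, w) < d \<Longrightarrow> dist (f (fst p) (snd p)) (f t w) < 1"
    by blast
  have "\<bar>f (t + x) (w + y)\<bar> \<le> \<bar>f t w\<bar> + 1" if "\<bar>x\<bar> < d / 2" "\<bar>y\<bar> < d / 2" for x y
  proof -
    have "dist (t + x, w + y) (t, w) \<le> \<bar>x\<bar> + \<bar>y\<bar>"
      by (simp add: dist_prod_def dist_real_def sqrt_sum_squares_le_sum_abs)
    with d(2)[of "(t + x, w + y)"] that show ?thesis by (auto simp: dist_real_def)
  qed
  with \<open>d > 0\<close> show ?case
    by (intro exI[of _ "\<bar>f t w\<bar> + 1"] exI[of _ "d/2"]) (simp add: taylor_poly_def)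
next
  case (Suc n)
  from Suc.prems have pt: "Ck_on n (pd_t f) S" and pu: "Ck_on n (pd_u f) S"
    and diff: "\<And>a b. (a, b) \<in> S \<Longrightarrow> (\<lambda>s. f s b) differentiable (at a) \<and> (\<lambda>v. f a v) differentiable (at b)"
    by auto
  have dt: "((\<lambda>s. f s b) has_real_derivative pd_t f a b) (at a)"
    and du: "((\<lambda>v. f a v) has_real_derivative pd_u f a b) (at b)" if "(a, b) \<in> S" for a b
    using diff[OF that] by (simp_all add: pd_t_def pd_u_def DERIV_deriv_iff_real_differentiable)
  obtain Ct dt' where Ct: "0 \<le> Ct" "0 < dt'" "\<And>x y. \<bar>x\<bar> < dt' \<Longrightarrow> \<bar>y\<bar> < dt' \<Longrightarrow>
      \<bar>pd_t f (t + x) (w + y) - taylor_poly n (pd_t f) t w x y\<bar> \<le> Ct * (\<bar>x\<bar> + \<bar>y\<bar>) ^ n"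
    using Suc.IH[OF pt] by blast
  obtain Cu du' where Cu: "0 \<le> Cu" "0 < du'" "\<And>x y. \<bar>x\<bar> < du' \<Longrightarrow> \<bar>y\<bar> < du' \<Longrightarrow>
      \<bar>pd_u f (t + x) (w + y) - taylor_poly n (pd_u f) t w x y\<bar> \<le> Cu * (\<bar>x\<bar> + \<bar>y\<bar>) ^ n"
    using Suc.IH[OF pu] by blast
  obtain r where r: "r > 0" "ball (t, w) r \<subseteq> S"
    using assms(1,2) by (auto simp: open_contains_ball)
  have inS: "(t + x, w + y) \<in> S" if "\<bar>x\<bar> < r / 2" "\<bar>y\<bar> < r / 2" for x y
  proof -
    have "dist (t, w) (t + x, w + y) \<le> \<bar>x\<bar> + \<bar>y\<bar>"
      by (simp add: dist_prod_def dist_real_def sqrt_sum_squares_le_sum_abs)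
    then show ?thesis using that by (intro subsetD[OF r(2)]) auto
  qed
  define d where "d = min (min dt' du') (r / 2)"
  have d: "0 < d" "d \<le> dt'" "d \<le> du'" "d \<le> r / 2"
    using Ct(2) Cu(2) r(1) by (auto simp: d_def)
  have "\<bar>f (t + x) (w + y) - taylor_poly (Suc n) f t w x y\<bar> \<le> (Ct + Cu) * (\<bar>x\<bar> + \<bar>y\<bar>) ^ Suc n"
    if xy: "\<bar>x\<bar> < d" "\<bar>y\<bar> < d" for x y
  proof -
    define R where "R x y = f (t + x) (w + y) - taylor_poly (Suc n) f t w x y" for x y
    have Rx: "((\<lambda>x. R x y) has_real_derivative
        pd_t f (t + s) (w + y) - taylor_poly n (pd_t f) t w s y) (at s)" if "\<bar>s\<bar> \<le> \<bar>x\<bar>" for s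
      unfolding R_def
      using inS[of s y] that xy d
      by (intro DERIV_diff taylor_poly_dx DERIV_shift_left[OF dt]) auto
    have Ry: "((\<lambda>y. R 0 y) has_real_derivative
        pd_u f (t + 0) (w + s) - taylor_poly n (pd_u f) t w 0 s) (at s)" if "\<bar>s\<bar> \<le> \<bar>y\<bar>" for s
      unfolding R_def
      using inS[of 0 s] that xy d
      by (intro DERIV_diff taylor_poly_zero_dy DERIV_shift_left[OF du]) auto
    have "\<bar>R x y - R 0 y\<bar> \<le> (Ct * (\<bar>x\<bar> + \<bar>y\<bar>) ^ n) * \<bar>x\<bar>"
    proof (rule mvt_bound_from_zero[OF Rx])
      fix s assume s: "\<bar>s\<bar> \<le> \<bar>x\<bar>"
      have "\<bar>pd_t f (t + s) (w + y) - taylor_poly n (pd_t f) t w s y\<bar> \<le> Ct * (\<bar>s\<bar> + \<bar>y\<bar>) ^ n"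
        using s xy d by (intro Ct(3)) auto
      also have "\<dots> \<le> Ct * (\<bar>x\<bar> + \<bar>y\<bar>) ^ n"
        using s Ct(1) by (intro mult_left_mono power_mono) auto
      finally show "\<bar>pd_t f (t + s) (w + y) - taylor_poly n (pd_t f) t w s y\<bar> \<le> \<dots>" .
    qed
    moreover have "\<bar>R 0 y - R 0 0\<bar> \<le> (Cu * (\<bar>x\<bar> + \<bar>y\<bar>) ^ n) * \<bar>y\<bar>"
    proof (rule mvt_bound_from_zero[OF Ry])
      fix s assume s: "\<bar>s\<bar> \<le> \<bar>y\<bar>"
      have "\<bar>pd_u f (t + 0) (w + s) - taylor_poly n (pd_u f) t w 0 s\<bar> \<le> Cu * (\<bar>0\<bar> + \<bar>s\<bar>) ^ n"
        using s xy d by (intro Cu(3)) auto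
      also have "\<dots> \<le> Cu * (\<bar>x\<bar> + \<bar>y\<bar>) ^ n"
        using s Cu(1) by (intro mult_left_mono power_mono) auto
      finally show "\<bar>pd_u f (t + 0) (w + s) - taylor_poly n (pd_u f) t w 0 s\<bar> \<le> \<dots>" .
    qed
    moreover have "R 0 0 = 0"
      unfolding R_def taylor_poly_zero_Suc by (subst sum.lessThan_Suc_shift) simp
    ultimately have "\<bar>R x y\<bar> \<le> (Ct * (\<bar>x\<bar> + \<bar>y\<bar>) ^ n) * \<bar>x\<bar> + (Cu * (\<bar>x\<bar> + \<bar>y\<bar>) ^ n) * \<bar>y\<bar>"
      by linarith
    also have "\<dots> \<le> (Ct * (\<bar>x\<bar> + \<bar>y\<bar>) ^ n) * (\<bar>x\<bar> + \<bar>y\<bar>) + (Cu * (\<bar>x\<bar> + \<bar>y\<bar>) ^ n) * (\<bar>x\<bar> + \<bar>y\<bar>)"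
      using Ct(1) Cu(1) by (intro add_mono mult_left_mono) auto
    also have "\<dots> = (Ct + Cu) * (\<bar>x\<bar> + \<bar>y\<bar>) ^ Suc n"
      by (simp add: algebra_simps)
    finally show ?thesis by (simp add: R_def)
  qed
  with d(1) Ct(1) Cu(1) show ?case
    by (intro exI[of _ "Ct + Cu"] exI[of _ d]) auto
qed

section \<open>Calculus of remainders at zero\<close>

lemma bigo_integrate:
  fixes g g' :: "real \<Rightarrow> real"
  assumes der: "\<forall>\<^sub>F h in nhds 0. (g has_real_derivative g' h) (at h)"
    and O: "g' \<in> O[at 0](\<lambda>h. h ^ n)" and "g 0 = 0"
  shows "g \<in> O[at 0](\<lambda>h. h ^ Suc n)"
proof -
  from O obtain C where "C > 0" and C: "\<forall>\<^sub>F h in at 0. norm (g' h) \<le> C * norm (h ^ n)"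
    by (elim landau_o.bigE)
  from C obtain d1 where d1: "d1 > 0" "\<And>h. h \<noteq> 0 \<Longrightarrow> \<bar>h\<bar> < d1 \<Longrightarrow> \<bar>g' h\<bar> \<le> C * \<bar>h\<bar> ^ n"
    by (auto simp: eventually_at power_abs)
  from der obtain d2 where d2: "d2 > 0" "\<And>h. \<bar>h\<bar> < d2 \<Longrightarrow> (g has_real_derivative g' h) (at h)"
    by (auto simp: eventually_nhds_metric)
  have "\<bar>g h\<bar> \<le> C * \<bar>h\<bar> ^ Suc n" if h: "\<bar>h\<bar> < min d1 d2" for h
  proof -
    have "\<bar>g h - g 0\<bar> \<le> C * \<bar>h\<bar> ^ n * \<bar>h\<bar>"
    proof (rule mvt_bound_from_zero)
      show "(g has_real_derivative g' s) (at s)" if "\<bar>s\<bar> \<le> \<bar>h\<bar>" for s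
        using d2(2) that h by auto
      show "\<bar>g' s\<bar> \<le> C * \<bar>h\<bar> ^ n" if "\<bar>s\<bar> \<le> \<bar>h\<bar>" "s \<noteq> 0" for s
      proof -
        have "\<bar>g' s\<bar> \<le> C * \<bar>s\<bar> ^ n" using d1(2) that h by auto
        also have "\<dots> \<le> C * \<bar>h\<bar> ^ n" using that \<open>C > 0\<close> by (intro mult_left_mono power_mono) auto
        finally show ?thesis .
      qed
    qed
    then show ?thesis using \<open>g 0 = 0\<close> by (simp add: ac_simps)
  qed
  then have "\<forall>\<^sub>F h in at 0. norm (g h) \<le> C * norm (h ^ Suc n)"
    using d1(1) d2(1) by (auto simp: eventually_at power_abs abs_mult intro!: exI[of _ "min d1 d2"])
  then show ?thesis by (rule landau_o.bigI[OF \<open>C > 0\<close>])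
qed


lemma bigo_power_times:
  fixes g :: "real \<Rightarrow> real"
  assumes "(g \<longlongrightarrow> l) (at 0)"
  shows "(\<lambda>h. h ^ n * g h) \<in> O[at 0](\<lambda>h. h ^ n)"
proof -
  have "g \<in> O[at 0](\<lambda>_. 1)"
    using assms by (intro bigoI_tendsto[where c = l]) auto
  then have "(\<lambda>h. h ^ n * g h) \<in> O[at 0](\<lambda>h. h ^ n * 1)"
    by (rule landau_o.big.mult_left)
  then show ?thesis by simp
qed

lemma bigo_power_mono:
  assumes "n \<le> m"
  shows "(\<lambda>h::real. h ^ m) \<in> O[at 0](\<lambda>h. h ^ n)"
proof -
  have "((\<lambda>h::real. h ^ (m - n)) \<longlongrightarrow> 0 ^ (m - n)) (at 0)"
    by (intro tendsto_intros)
  from bigo_power_times[OF this, of n] assms show ?thesis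
    by (simp flip: power_add)
qed

lemma bigo_linear_tendsto_0:
  fixes y :: "real \<Rightarrow> real"
  assumes "y \<in> O[at 0](\<lambda>h. h)"
  shows "(y \<longlongrightarrow> 0) (at 0)"
proof -
  have "(\<lambda>h::real. h) \<in> o[at 0](\<lambda>_. 1)"
    by (intro smalloI_tendsto) auto
  with assms have "y \<in> o[at 0](\<lambda>_. 1)"
    by (rule landau_o.big_small_trans)
  then show ?thesis using smalloD_tendsto by fastforce
qed

text \<open>
  The derivative is \<open>- 2 a h (exp (- a h^2) - 1)\<close>, and the derivative of the last factor is
  \<open>O(h)\<close>; integrating twice gives order four.
\<close>
lemma exp_square_bigo:
  "(\<lambda>h::real. exp (- a * h ^ 2) - (1 - a * h ^ 2)) \<in> O[at 0](\<lambda>h. h ^ 4)"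
proof -
  have exp_lim: "((\<lambda>h::real. c * exp (- a * h ^ 2)) \<longlongrightarrow> c) (at 0)" for c
    by (rule tendsto_eq_intros refl | simp)+
  have "(\<lambda>h. - 2 * a * h * exp (- a * h ^ 2)) \<in> O[at 0](\<lambda>h. h ^ 1)"
    using bigo_power_times[OF exp_lim, of 1 "- 2 * a"] by (simp add: ac_simps)
  then have "(\<lambda>h. exp (- a * h ^ 2) - 1) \<in> O[at 0](\<lambda>h. h ^ Suc 1)"
    by (rule bigo_integrate[rotated])
       (auto intro!: always_eventually derivative_eq_intros)
  then have "(\<lambda>h. - 2 * a * h * (exp (- a * h ^ 2) - 1)) \<in> O[at 0](\<lambda>h. - 2 * a * h * h ^ Suc 1)"
    by (rule landau_o.big.mult_left)
  also have "(\<lambda>h. - 2 * a * h * h ^ Suc 1) \<in> O[at 0](\<lambda>h. h ^ 3)"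
    using bigo_power_times[OF tendsto_const, of 3 "- 2 * a"] by (simp add: ac_simps power2_eq_square power3_eq_cube)
  finally have "(\<lambda>h. exp (- a * h ^ 2) - (1 - a * h ^ 2)) \<in> O[at 0](\<lambda>h. h ^ Suc 3)"
    by (rule bigo_integrate[rotated])
       (auto intro!: always_eventually derivative_eq_intros simp: algebra_simps)
  then show ?thesis by (simp add: eval_nat_numeral)
qed

section \<open>Expansion of a smooth field along a curve\<close>

locale smooth_near =
  fixes f :: "real \<Rightarrow> real \<Rightarrow> real" and S :: "(real \<times> real) set" and t w :: real
  assumes open_S: "open S" and base_point: "(t, w) \<in> S" and smooth: "Ck_on 4 f S"
begin

abbreviation "F \<equiv> f t w"
abbreviation "ft \<equiv> pd_t f t w"
abbreviation "fu \<equiv> pd_u f t w"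
abbreviation "ftt \<equiv> pd_t (pd_t f) t w"
abbreviation "ftu \<equiv> pd_u (pd_t f) t w"
abbreviation "fuu \<equiv> pd_u (pd_u f) t w"
abbreviation "fttt \<equiv> pd_t (pd_t (pd_t f)) t w"
abbreviation "fttu \<equiv> pd_u (pd_t (pd_t f)) t w"
abbreviation "ftuu \<equiv> pd_u (pd_u (pd_t f)) t w"
abbreviation "fuuu \<equiv> pd_u (pd_u (pd_u f)) t w"

text \<open>
  The coefficients of \<open>h\<close>, \<open>h^2\<close>, \<open>h^3\<close> in \<open>f (t + c h) (w + y1 h + y2 h^2 + y3 h^3)\<close>.
\<close>
definition "coeff1 c y1 = c * ft + y1 * fu"
definition "coeff2 c y1 y2 = y2 * fu + (c^2 * ftt + 2 * c * y1 * ftu + y1^2 * fuu) / 2"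
definition "coeff3 c y1 y2 y3 =
  y3 * fu + y2 * (c * ftu + y1 * fuu)
    + (c^3 * fttt + 3 * c^2 * y1 * fttu + 3 * c * y1^2 * ftuu + y1^3 * fuuu) / 6"

lemma taylor_poly_4:
  "taylor_poly 4 f t w x y =
     F + fu * y + fuu / 2 * y^2 + fuuu / 6 * y^3
       + x * (ft + ftu * y + ftuu / 2 * y^2) + x^2 / 2 * (ftt + fttu * y) + x^3 / 6 * fttt"
  unfolding taylor_poly_def by (simp add: eval_nat_numeral field_simps)

lemma taylor_bigo:
  assumes "y \<in> O[at 0](\<lambda>h. h)"
  shows "(\<lambda>h. f (t + c * h) (w + y h) - taylor_poly 4 f t w (c * h) (y h)) \<in> O[at 0](\<lambda>h. h ^ 4)"
proof -
  obtain C d where C: "0 \<le> C" "0 < d" "\<And>x y. \<bar>x\<bar> < d \<Longrightarrow> \<bar>y\<bar> < d \<Longrightarrow>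
      \<bar>f (t + x) (w + y) - taylor_poly 4 f t w x y\<bar> \<le> C * (\<bar>x\<bar> + \<bar>y\<bar>) ^ 4"
    using taylor_bound[OF open_S base_point smooth] by blast
  obtain K where K: "K > 0" "\<forall>\<^sub>F h in at 0. norm (y h) \<le> K * norm h"
    using assms by (elim landau_o.bigE)
  have small: "\<forall>\<^sub>F h in at 0. \<bar>z h\<bar> < d" if "(z \<longlongrightarrow> 0) (at 0)" for z :: "real \<Rightarrow> real"
    using tendstoD[OF that C(2)] by (simp add: dist_real_def)
  have "((\<lambda>h. c * h) \<longlongrightarrow> 0) (at 0)"
    by (rule tendsto_eq_intros refl | simp)+
  from small[OF this] small[OF bigo_linear_tendsto_0[OF assms]] K(2)
  have "\<forall>\<^sub>F h in at 0. norm (f (t + c * h) (w + y h) - taylor_poly 4 f t w (c * h) (y h))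
      \<le> (C * (\<bar>c\<bar> + K) ^ 4) * norm (h ^ 4)"
  proof eventually_elim
    case (elim h)
    have "\<bar>f (t + c * h) (w + y h) - taylor_poly 4 f t w (c * h) (y h)\<bar>
        \<le> C * (\<bar>c * h\<bar> + \<bar>y h\<bar>) ^ 4"
      using elim by (intro C(3)) auto
    also have "\<dots> \<le> C * ((\<bar>c\<bar> + K) * \<bar>h\<bar>) ^ 4"
      using elim C(1) by (intro mult_left_mono power_mono) (auto simp: abs_mult algebra_simps)
    finally show ?case by (simp add: power_mult_distrib power_abs)
  qed
  then show ?thesis by (rule bigoI)
qed

text \<open>
  With \<open>P\<close> the Taylor polynomial and \<open>q\<close> the given cubic, the error splits into the Taylor remainder
  at \<open>y\<close>, the difference \<open>P(y) - P(q)\<close>, which has the factor \<open>y - q\<close>, and the terms of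
  \<open>P(q)\<close> of degree at least four. Admitting every precision \<open>n\<close> from \<open>1\<close> to \<open>4\<close>, with
  meaningless higher coefficients when \<open>n\<close> is small, is what allows the expansion of the
  solution to be built up one order at a time.
\<close>
lemma expansion_along_curve:
  assumes y: "(\<lambda>h. y h - (y1 * h + y2 * h^2 + y3 * h^3)) \<in> O[at 0](\<lambda>h. h ^ n)"
    and n: "1 \<le> n" "n \<le> 4"
  shows "(\<lambda>h. f (t + c * h) (w + y h)
            - (F + coeff1 c y1 * h + coeff2 c y1 y2 * h^2 + coeff3 c y1 y2 y3 * h^3))
         \<in> O[at 0](\<lambda>h. h ^ n)"
proof -
  define q where "q h = y1 * h + y2 * h^2 + y3 * h^3" for h
  define v z where "v h = y2 + y3 * h" and "z h = y1 + h * v h" for h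
  have "(\<lambda>h. h ^ 1 * z h) \<in> O[at 0](\<lambda>h. h ^ 1)"
    unfolding z_def v_def by (rule bigo_power_times) (rule tendsto_intros)+
  moreover have "(\<lambda>h. y h - q h) \<in> O[at 0](\<lambda>h. h ^ 1)"
    using landau_o.big_trans[OF y bigo_power_mono[OF n(1)]] by (simp add: q_def)
  ultimately have "(\<lambda>h. (y h - q h) + h ^ 1 * z h) \<in> O[at 0](\<lambda>h. h ^ 1)"
    by (rule sum_in_bigo(1)[rotated])
  then have y_lin: "y \<in> O[at 0](\<lambda>h. h)"
    by (simp add: q_def z_def v_def algebra_simps power2_eq_square power3_eq_cube)
  define P where "P h y = taylor_poly 4 f t w (c * h) y" for h y
  have 1: "(\<lambda>h. f (t + c * h) (w + y h) - P h (y h)) \<in> O[at 0](\<lambda>h. h ^ n)"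
    unfolding P_def by (rule landau_o.big_trans[OF taylor_bigo[OF y_lin] bigo_power_mono[OF n(2)]])
  have "(y \<longlongrightarrow> 0) (at 0)"
    by (rule bigo_linear_tendsto_0[OF y_lin])
  then have "((\<lambda>h. fu + fuu / 2 * (y h + q h) + fuuu / 6 * (y h^2 + y h * q h + q h^2)
      + c * h * (ftu + ftuu / 2 * (y h + q h)) + (c * h)^2 / 2 * fttu) \<longlongrightarrow> fu) (at 0)"
    unfolding q_def by (auto intro!: tendsto_eq_intros)
  then have "(\<lambda>h. fu + fuu / 2 * (y h + q h) + fuuu / 6 * (y h^2 + y h * q h + q h^2)
      + c * h * (ftu + ftuu / 2 * (y h + q h)) + (c * h)^2 / 2 * fttu) \<in> O[at 0](\<lambda>_. 1)"
    by (intro bigoI_tendsto[where c = fu]) auto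
  \<comment> \<open>The bounded factor is the difference quotient of \<open>P h\<close> between \<open>q h\<close> and \<open>y h\<close>.\<close>
  from landau_o.big_mult[OF y this]
  have 2: "(\<lambda>h. P h (y h) - P h (q h)) \<in> O[at 0](\<lambda>h. h ^ n)"
  proof -
    have "P h (y h) - P h (q h) = (y h - q h) *
      (fu + fuu / 2 * (y h + q h) + fuuu / 6 * (y h^2 + y h * q h + q h^2)
        + c * h * (ftu + ftuu / 2 * (y h + q h)) + (c * h)^2 / 2 * fttu)" for h
      unfolding P_def taylor_poly_4
      by (simp add: field_simps power2_eq_square power3_eq_cube)
    then show ?thesis using \<open>_ \<in> O[at 0](\<lambda>h. h ^ n * 1)\<close> by (simp add: q_def)
  qed
  \<comment> \<open>The tail of \<open>P h (q h)\<close> divided by \<open>h^4\<close>, using \<open>q = h z\<close> and \<open>z = y1 + h v\<close>.\<close>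
  have "((\<lambda>h. fuu / 2 * (2 * y1 * y3 + v h^2) + fuuu / 6 * v h * (z h^2 + z h * y1 + y1^2)
      + c * ftu * y3 + c * ftuu / 2 * v h * (z h + y1) + c^2 / 2 * fttu * v h)
      \<longlongrightarrow> fuu / 2 * (2 * y1 * y3 + v 0^2) + fuuu / 6 * v 0 * (z 0^2 + z 0 * y1 + y1^2)
      + c * ftu * y3 + c * ftuu / 2 * v 0 * (z 0 + y1) + c^2 / 2 * fttu * v 0) (at 0)"
    unfolding z_def v_def by (intro tendsto_intros)
  moreover have "P h (q h) - (F + coeff1 c y1 * h + coeff2 c y1 y2 * h^2 + coeff3 c y1 y2 y3 * h^3) =
    h^4 * (fuu / 2 * (2 * y1 * y3 + v h^2) + fuuu / 6 * v h * (z h^2 + z h * y1 + y1^2)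
      + c * ftu * y3 + c * ftuu / 2 * v h * (z h + y1) + c^2 / 2 * fttu * v h)" for h
    unfolding P_def taylor_poly_4 coeff1_def coeff2_def coeff3_def q_def z_def v_def
    by (simp add: field_simps power2_eq_square power3_eq_cube power4_eq_xxxx)
  ultimately have "(\<lambda>h. P h (q h) - (F + coeff1 c y1 * h + coeff2 c y1 y2 * h^2 + coeff3 c y1 y2 y3 * h^3))
      \<in> O[at 0](\<lambda>h. h ^ 4)"
    by (simp only: bigo_power_times)
  from landau_o.big_trans[OF this bigo_power_mono[OF n(2)]]
  have "(\<lambda>h. P h (q h) - (F + coeff1 c y1 * h + coeff2 c y1 y2 * h^2 + coeff3 c y1 y2 y3 * h^3))
      \<in> O[at 0](\<lambda>h. h ^ n)" .
  from sum_in_bigo(1)[OF sum_in_bigo(1)[OF 1 2] this] show ?thesis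
    by (simp add: algebra_simps)
qed

end

section \<open>Expansion of the solution\<close>

locale smooth_solution = smooth_near f S t "u t"
  for f :: "real \<Rightarrow> real \<Rightarrow> real" and S :: "(real \<times> real) set" and t :: real
    and u :: "real \<Rightarrow> real" +
  assumes solution: "\<forall>\<^sub>F s in nhds t. (u has_real_derivative f s (u s)) (at s)"
begin

lemma solution_shifted:
  "\<forall>\<^sub>F h in nhds 0. (u has_real_derivative f (t + h) (u (t + h))) (at (t + h))"
proof -
  have "filterlim (\<lambda>h. t + h) (nhds t) (nhds 0)"
    by (rule tendsto_eq_intros refl filterlim_ident | simp)+
  from filterlim_iff[THEN iffD1, rule_format, OF this solution] show ?thesis .
qed

text \<open>
  The right-hand side of the differential equation inherits the precision of \<open>u\<close>, and
  integration gains one order.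
\<close>
lemma picard_step:
  assumes y: "(\<lambda>h. (u (t + h) - u t) - (y1 * h + y2 * h^2 + y3 * h^3)) \<in> O[at 0](\<lambda>h. h ^ n)"
    and n: "1 \<le> n" "n \<le> 4"
  shows "(\<lambda>h. (u (t + h) - u t)
            - (F * h + coeff1 1 y1 / 2 * h^2 + coeff2 1 y1 y2 / 3 * h^3 + coeff3 1 y1 y2 y3 / 4 * h^4))
         \<in> O[at 0](\<lambda>h. h ^ Suc n)"
proof (rule bigo_integrate)
  show "(\<lambda>h. f (t + h) (u (t + h))
            - (F + coeff1 1 y1 * h + coeff2 1 y1 y2 * h^2 + coeff3 1 y1 y2 y3 * h^3))
         \<in> O[at 0](\<lambda>h. h ^ n)"
    using expansion_along_curve[OF assms, of 1] by simp
  show "\<forall>\<^sub>F h in nhds 0. ((\<lambda>h. (u (t + h) - u t)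
            - (F * h + coeff1 1 y1 / 2 * h^2 + coeff2 1 y1 y2 / 3 * h^3 + coeff3 1 y1 y2 y3 / 4 * h^4))
     has_real_derivative f (t + h) (u (t + h))
            - (F + coeff1 1 y1 * h + coeff2 1 y1 y2 * h^2 + coeff3 1 y1 y2 y3 * h^3)) (at h)"
    using solution_shifted
  proof eventually_elim
    case (elim h)
    note [derivative_intros] = DERIV_shift_left[OF elim]
    show ?case
      by (auto intro!: derivative_eq_intros)
  qed
qed simp

text \<open>
  The Taylor coefficients of \<open>u\<close> at \<open>t\<close>, i.e. derivatives divided by factorials.
\<close>
definition "u2 = coeff1 1 F / 2"
definition "u3 = coeff2 1 F u2 / 3"
definition "u4 = coeff3 1 F u2 u3 / 4"

lemma picard_step_truncated:
  assumes y: "(\<lambda>h. (u (t + h) - u t) - (y1 * h + y2 * h^2 + y3 * h^3)) \<in> O[at 0](\<lambda>h. h ^ n)"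
    and n: "1 \<le> n" "n \<le> 3"
  shows "(\<lambda>h. (u (t + h) - u t)
            - (F * h + coeff1 1 y1 / 2 * h^2 + coeff2 1 y1 y2 / 3 * h^3))
         \<in> O[at 0](\<lambda>h. h ^ Suc n)"
proof -
  have "(\<lambda>h. h ^ 4 * (coeff3 1 y1 y2 y3 / 4)) \<in> O[at 0](\<lambda>h. h ^ 4)"
    by (rule bigo_power_times) (rule tendsto_const)
  also have "(\<lambda>h::real. h ^ 4) \<in> O[at 0](\<lambda>h. h ^ Suc n)"
    using n by (intro bigo_power_mono) auto
  finally have "(\<lambda>h. h ^ 4 * (coeff3 1 y1 y2 y3 / 4)) \<in> O[at 0](\<lambda>h. h ^ Suc n)" .
  from sum_in_bigo(1)[OF picard_step[OF y] this] n show ?thesis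
    by (simp add: algebra_simps)
qed

text \<open>
  Three steps, starting from \<open>u (t + h) - u t = O(h)\<close> with zero coefficients. After step \<open>k\<close> the
  first \<open>k\<close> coefficients have reached their final value; the later ones are placeholders hidden
  by the error term.
\<close>
lemma solution_expansion_3:
  "(\<lambda>h. (u (t + h) - u t) - (F * h + u2 * h^2 + u3 * h^3)) \<in> O[at 0](\<lambda>h. h ^ 4)"
proof -
  have "(u has_real_derivative F) (at t)"
    using eventually_nhds_x_imp_x[OF solution] .
  then have "((\<lambda>h. (u (t + h) - u t) / h) \<longlongrightarrow> F) (at 0)"
    by (simp add: DERIV_def)
  from bigo_power_times[OF this, of 1]
  have "(\<lambda>h. h * ((u (t + h) - u t) / h)) \<in> O[at 0](\<lambda>h. h ^ 1)"
    by simp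
  moreover have "(\<lambda>h. h * ((u (t + h) - u t) / h)) = (\<lambda>h. u (t + h) - u t)"
    by (auto simp: fun_eq_iff)
  ultimately have "(\<lambda>h. (u (t + h) - u t) - (0 * h + 0 * h^2 + 0 * h^3)) \<in> O[at 0](\<lambda>h. h ^ 1)"
    by simp
  from picard_step_truncated[OF this]
  have "(\<lambda>h. (u (t + h) - u t)
            - (F * h + coeff1 1 0 / 2 * h^2 + coeff2 1 0 0 / 3 * h^3)) \<in> O[at 0](\<lambda>h. h ^ 2)"
    by (simp add: numeral_2_eq_2)
  from picard_step_truncated[OF this]
  have "(\<lambda>h. (u (t + h) - u t)
            - (F * h + u2 * h^2 + coeff2 1 F (coeff1 1 0 / 2) / 3 * h^3)) \<in> O[at 0](\<lambda>h. h ^ 3)"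
    by (simp add: u2_def numeral_3_eq_3)
  from picard_step_truncated[OF this] show ?thesis
    by (simp add: u2_def u3_def)
qed

lemma solution_expansion_4:
  "(\<lambda>h. (u (t + h) - u t) - (F * h + u2 * h^2 + u3 * h^3 + u4 * h^4)) \<in> O[at 0](\<lambda>h. h ^ 5)"
  using picard_step[OF solution_expansion_3] by (simp add: u2_def u3_def u4_def)

lemma second_derivative: "deriv (deriv u) t = ft + fu * F"
proof -
  have ev: "\<forall>\<^sub>F s in nhds t. deriv u s = f s (u s)"
    using solution by eventually_elim (rule DERIV_imp_deriv)
  have "(\<lambda>h. f (t + 1 * h) (u t + (u (t + h) - u t))
            - (F + coeff1 1 F * h + coeff2 1 F u2 * h^2 + coeff3 1 F u2 u3 * h^3))
         \<in> O[at 0](\<lambda>h. h ^ 4)"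
    by (rule expansion_along_curve[OF solution_expansion_3]) auto
  also have "(\<lambda>h::real. h ^ 4) \<in> O[at 0](\<lambda>h. h ^ 2)"
    by (rule bigo_power_mono) simp
  finally have "(\<lambda>h. f (t + h) (u (t + h))
            - (F + coeff1 1 F * h + coeff2 1 F u2 * h^2 + coeff3 1 F u2 u3 * h^3))
         \<in> O[at 0](\<lambda>h. h ^ 2)" by simp
  moreover have "((\<lambda>h. coeff2 1 F u2 + coeff3 1 F u2 u3 * h) \<longlongrightarrow> coeff2 1 F u2 + coeff3 1 F u2 u3 * 0) (at 0)"
    by (intro tendsto_intros)
  from bigo_power_times[OF this, of 2]
  have "(\<lambda>h. h ^ 2 * (coeff2 1 F u2 + coeff3 1 F u2 u3 * h)) \<in> O[at 0](\<lambda>h. h ^ 2)" .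
  ultimately have "(\<lambda>h. (f (t + h) (u (t + h))
            - (F + coeff1 1 F * h + coeff2 1 F u2 * h^2 + coeff3 1 F u2 u3 * h^3))
        + h ^ 2 * (coeff2 1 F u2 + coeff3 1 F u2 u3 * h)) \<in> O[at 0](\<lambda>h. h ^ 2)"
    by (rule sum_in_bigo(1))
  then have "(\<lambda>h. (f (t + h) (u (t + h)) - F) - coeff1 1 F * h) \<in> O[at 0](\<lambda>h. h ^ 2)"
    by (simp add: algebra_simps power2_eq_square power3_eq_cube)
  also have "(\<lambda>h::real. h ^ 2) \<in> o[at 0](\<lambda>h. h)"
    by (intro smalloI_tendsto)
       (auto simp: power2_eq_square eventually_at intro!: tendsto_eq_intros exI[of _ 1])
  finally have "((\<lambda>h. ((f (t + h) (u (t + h)) - F) - coeff1 1 F * h) / h) \<longlongrightarrow> 0) (at 0)"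
    by (rule smalloD_tendsto)
  then have "((\<lambda>h. ((f (t + h) (u (t + h)) - F) - coeff1 1 F * h) / h + coeff1 1 F) \<longlongrightarrow> 0 + coeff1 1 F) (at 0)"
    by (intro tendsto_intros)
  moreover have "\<forall>\<^sub>F h in at 0. ((f (t + h) (u (t + h)) - F) - coeff1 1 F * h) / h + coeff1 1 F
      = (f (t + h) (u (t + h)) - F) / h"
    by (auto simp: eventually_at field_simps intro!: exI[of _ 1])
  ultimately have "((\<lambda>h. (f (t + h) (u (t + h)) - F) / h) \<longlongrightarrow> coeff1 1 F) (at 0)"
    using tendsto_cong by force
  then have "((\<lambda>s. f s (u s)) has_real_derivative coeff1 1 F) (at t)"
    by (simp add: DERIV_def)
  then have "deriv (\<lambda>s. f s (u s)) t = coeff1 1 F"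
    by (rule DERIV_imp_deriv)
  with deriv_cong_ev[OF ev refl] show ?thesis by (simp add: coeff1_def)
qed

section \<open>Expansion of the stages and of the truncation error\<close>

lemma shape_factor_bigo:
  "(\<lambda>h. u t * (exp (- e * (c * h) ^ 2) - 1) - (- (e * c^2 * u t)) * h^2) \<in> O[at 0](\<lambda>h. h ^ 4)"
proof -
  have "(\<lambda>h. u t * (exp (- (e * c^2) * h^2) - (1 - e * c^2 * h^2))) \<in> O[at 0](\<lambda>h. h ^ 4)"
    using exp_square_bigo[of "e * c^2"] by (cases "u t = 0") simp_all
  then show ?thesis by (simp add: algebra_simps power_mult_distrib)
qed

lemma stage2_expansion:
  assumes "a21 M = c2 M"
  defines "k1 \<equiv> coeff1 (c2 M) (c2 M * F)"
    and "k2 \<equiv> coeff2 (c2 M) (c2 M * F) (- (eps2sq M * (c2 M)^2 * u t))"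
    and "k3 \<equiv> coeff3 (c2 M) (c2 M * F) (- (eps2sq M * (c2 M)^2 * u t)) 0"
  shows "(\<lambda>h. stage2 M f t (u t) h - (F + k1 * h + k2 * h^2 + k3 * h^3)) \<in> O[at 0](\<lambda>h. h ^ 4)"
proof -
  have "(\<lambda>h. (u t * (exp (- eps2sq M * (c2 M * h) ^ 2) - 1) + h * (a21 M * F))
         - (c2 M * F * h + - (eps2sq M * (c2 M)^2 * u t) * h^2 + 0 * h^3)) \<in> O[at 0](\<lambda>h. h ^ 4)"
    using shape_factor_bigo[of "eps2sq M" "c2 M"] assms(1) by (simp add: algebra_simps)
  from expansion_along_curve[OF this, of "c2 M"] show ?thesis
    by (simp add: stage2_def stage1_def k1_def k2_def k3_def algebra_simps)
qed

lemma stage3_expansion: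
  assumes "a21 M = c2 M" "a31 M + a32 M = c3 M"
  defines "y2 \<equiv> - (eps3sq M * (c3 M)^2 * u t) + a32 M * coeff1 (c2 M) (c2 M * F)"
    and "y3 \<equiv> a32 M * coeff2 (c2 M) (c2 M * F) (- (eps2sq M * (c2 M)^2 * u t))"
  defines "k1 \<equiv> coeff1 (c3 M) (c3 M * F)"
    and "k2 \<equiv> coeff2 (c3 M) (c3 M * F) y2"
    and "k3 \<equiv> coeff3 (c3 M) (c3 M * F) y2 y3"
  shows "(\<lambda>h. stage3 M f t (u t) h - (F + k1 * h + k2 * h^2 + k3 * h^3)) \<in> O[at 0](\<lambda>h. h ^ 4)"
proof -
  define K1 where "K1 = coeff1 (c2 M) (c2 M * F)"
  define K2 where "K2 = coeff2 (c2 M) (c2 M * F) (- (eps2sq M * (c2 M)^2 * u t))"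
  define K3 where "K3 = coeff3 (c2 M) (c2 M * F) (- (eps2sq M * (c2 M)^2 * u t)) 0"
  note s2 = stage2_expansion[OF assms(1), folded K1_def K2_def K3_def]
  have "((\<lambda>h. a32 M * h) \<longlongrightarrow> a32 M * 0) (at 0)"
    by (intro tendsto_intros)
  then have "(\<lambda>h. a32 M * h) \<in> O[at 0](\<lambda>_. 1)"
    by (intro bigoI_tendsto[where c = 0]) auto
  from landau_o.big_mult[OF this s2]
  have "(\<lambda>h. a32 M * h * (stage2 M f t (u t) h - (F + K1 * h + K2 * h^2 + K3 * h^3))) \<in> O[at 0](\<lambda>h. h ^ 4)"
    by simp
  moreover have "(\<lambda>h. h ^ 4 * (a32 M * K3)) \<in> O[at 0](\<lambda>h. h ^ 4)"
    by (rule bigo_power_times) (rule tendsto_const)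
  ultimately have "(\<lambda>h. a32 M * h * (stage2 M f t (u t) h - (F + K1 * h + K2 * h^2 + K3 * h^3))
      + h ^ 4 * (a32 M * K3)) \<in> O[at 0](\<lambda>h. h ^ 4)"
    by (rule sum_in_bigo(1))
  from sum_in_bigo(1)[OF shape_factor_bigo[of "eps3sq M" "c3 M"] this]
  have "(\<lambda>h. (u t * (exp (- eps3sq M * (c3 M * h) ^ 2) - 1)
              + h * (a31 M * F + a32 M * stage2 M f t (u t) h))
         - (c3 M * F * h + y2 * h^2 + y3 * h^3)) \<in> O[at 0](\<lambda>h. h ^ 4)"
    unfolding assms(2)[symmetric] y2_def y3_def K1_def[symmetric] K2_def[symmetric]
    by (simp add: algebra_simps power2_eq_square power3_eq_cube power4_eq_xxxx)
  from expansion_along_curve[OF this, of "c3 M"] show ?thesis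
    by (simp add: stage3_def stage1_def k1_def k2_def k3_def algebra_simps)
qed

text \<open>
  Under the conditions for order three this is twenty-four times the coefficient of \<open>h^3\<close> in the
  local truncation error. The products \<open>a32 b3 c2\<close> that the third stage brings in have been
  replaced by \<open>1/6\<close>.
\<close>
definition error_coeff :: "rbf_rk3 \<Rightarrow> real" where
  "error_coeff M =
     (fttt + 3 * fttu * F + 3 * ftuu * F^2 + fuuu * F^3)
         * (1 - 4 * (b2 M * (c2 M)^3 + b3 M * (c3 M)^3))
     + (ftu + fuu * F) * (ft + fu * F) * (3 - 4 * c3 M)
     + fu * (ftt + 2 * ftu * F + fuu * F^2) * (1 - 2 * c2 M)
     + fu^2 * (ft + fu * F)
     + 4 * u t * (6 * (b2 M * (c2 M)^3 * eps2sq M + b3 M * (c3 M)^3 * eps3sq M) * (ftu + fuu * F)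
         + c2 M * eps2sq M * fu^2)"

definition order3_conditions :: "rbf_rk3 \<Rightarrow> bool" where
  "order3_conditions M \<longleftrightarrow>
      b1 M + b2 M + b3 M = 1 \<and> a21 M = c2 M \<and> a31 M + a32 M = c3 M \<and>
      b2 M * c2 M + b3 M * c3 M = 1/2 \<and> b2 M * (c2 M)^2 + b3 M * (c3 M)^2 = 1/3 \<and>
      a32 M * b3 M * c2 M = 1/6 \<and>
      b2 M * (c2 M)^2 * eps2sq M + b3 M * (c3 M)^2 * eps3sq M = 0"

text \<open>
  Each coefficient of the truncation error is written as a combination of the defects of the
  conditions for order three (for \<open>h^3\<close>, plus \<open>error_coeff M / 24\<close>), after which these defects are
  replaced by zero.
\<close>
lemma truncation_error_expansion:
  assumes "order3_conditions M"
  shows "(\<lambda>h. local_truncation_error M f u t h - error_coeff M / 24 * h^3) \<in> O[at 0](\<lambda>h. h ^ 4)"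
proof -
  define K1 where "K1 = coeff1 (c2 M) (c2 M * F)"
  define K2 where "K2 = coeff2 (c2 M) (c2 M * F) (- (eps2sq M * (c2 M)^2 * u t))"
  define K3 where "K3 = coeff3 (c2 M) (c2 M * F) (- (eps2sq M * (c2 M)^2 * u t)) 0"
  define y2 where "y2 = - (eps3sq M * (c3 M)^2 * u t) + a32 M * K1"
  define L1 where "L1 = coeff1 (c3 M) (c3 M * F)"
  define L2 where "L2 = coeff2 (c3 M) (c3 M * F) y2"
  define L3 where "L3 = coeff3 (c3 M) (c3 M * F) y2 (a32 M * K2)"
  have a: "a21 M = c2 M" "a31 M + a32 M = c3 M"
    using assms by (auto simp: order3_conditions_def)
  define E0 where "E0 h = (u (t + h) - u t) - (F * h + u2 * h^2 + u3 * h^3 + u4 * h^4)" for h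
  define E2 where "E2 h = stage2 M f t (u t) h - (F + K1 * h + K2 * h^2 + K3 * h^3)" for h
  define E3 where "E3 h = stage3 M f t (u t) h - (F + L1 * h + L2 * h^2 + L3 * h^3)" for h
  have "E0 \<in> O[at 0](\<lambda>h. h ^ 5)"
    using solution_expansion_4 unfolding E0_def .
  then have "(\<lambda>h. 1 / h * E0 h) \<in> O[at 0](\<lambda>h. 1 / h * h ^ 5)"
    by (rule landau_o.big.mult_left)
  also have "(\<lambda>h::real. 1 / h * h ^ 5) = (\<lambda>h. h ^ 4)"
    by (auto simp: fun_eq_iff eval_nat_numeral)
  finally have E0: "(\<lambda>h. 1 / h * E0 h) \<in> O[at 0](\<lambda>h. h ^ 4)" .
  have E2: "E2 \<in> O[at 0](\<lambda>h. h ^ 4)"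
    using stage2_expansion[OF a(1)] unfolding E2_def K1_def K2_def K3_def .
  have E3: "E3 \<in> O[at 0](\<lambda>h. h ^ 4)"
    using stage3_expansion[OF a] unfolding E3_def y2_def L1_def L2_def L3_def K1_def K2_def .
  have const_mult: "(\<lambda>h. b * E h) \<in> O[at 0](\<lambda>h. h ^ 4)" if "E \<in> O[at 0](\<lambda>h. h ^ 4)"
    for b :: real and E :: "real \<Rightarrow> real"
    using that by (cases "b = 0") simp_all
  have O: "(\<lambda>h. 1 / h * E0 h - b2 M * E2 h - b3 M * E3 h) \<in> O[at 0](\<lambda>h. h ^ 4)"
    by (intro sum_in_bigo E0 E2 E3 const_mult)
  have conds: "b1 M + b2 M + b3 M = 1" "b2 M * c2 M + b3 M * c3 M = 1/2"
    "b2 M * (c2 M)^2 + b3 M * (c3 M)^2 = 1/3" "a32 M * b3 M * c2 M = 1/6"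
    "b2 M * (c2 M)^2 * eps2sq M + b3 M * (c3 M)^2 * eps3sq M = 0"
    using assms unfolding order3_conditions_def by blast+
  note unfolds = u4_def u3_def u2_def K1_def K2_def K3_def L1_def L2_def L3_def y2_def
    coeff1_def coeff2_def coeff3_def error_coeff_def
  have "F - (b1 M * F + b2 M * F + b3 M * F) = (1 - (b1 M + b2 M + b3 M)) * F"
    by (simp add: algebra_simps)
  then have T0: "F - (b1 M * F + b2 M * F + b3 M * F) = 0"
    unfolding conds by simp
  have "u2 - (b2 M * K1 + b3 M * L1) = (1/2 - (b2 M * c2 M + b3 M * c3 M)) * (ft + fu * F)"
    by (simp add: unfolds field_simps)
  then have T1: "u2 - (b2 M * K1 + b3 M * L1) = 0"
    unfolding conds by simp
  have "u3 - (b2 M * K2 + b3 M * L2) =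
      (1/3 - (b2 M * (c2 M)^2 + b3 M * (c3 M)^2)) * (ftt + 2 * ftu * F + fuu * F^2) / 2
      + (1/6 - a32 M * b3 M * c2 M) * fu * (ft + fu * F)
      + fu * u t * (b2 M * (c2 M)^2 * eps2sq M + b3 M * (c3 M)^2 * eps3sq M)"
    by (simp add: unfolds field_simps power2_eq_square)
  then have T2: "u3 - (b2 M * K2 + b3 M * L2) = 0"
    unfolding conds by simp
  have "u4 - (b2 M * K3 + b3 M * L3) = error_coeff M / 24
      + (1/6 - a32 M * b3 M * c2 M) * (c3 M * (ftu + fuu * F) * (ft + fu * F)
          + c2 M * fu * (ftt + 2 * ftu * F + fuu * F^2) / 2 - u t * c2 M * eps2sq M * fu^2)"
    by (simp add: unfolds field_simps power2_eq_square power3_eq_cube)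
  then have T3: "u4 - (b2 M * K3 + b3 M * L3) = error_coeff M / 24"
    unfolding conds by simp
  have "1 / h * E0 h - b2 M * E2 h - b3 M * E3 h
      = local_truncation_error M f u t h - error_coeff M / 24 * h^3" if "h \<noteq> 0" for h
  proof -
    have "1 / h * E0 h = (u (t + h) - u t) / h - (F + u2 * h + u3 * h^2 + u4 * h^3)"
      using that by (simp add: E0_def field_simps eval_nat_numeral)
    then have "1 / h * E0 h - b2 M * E2 h - b3 M * E3 h = local_truncation_error M f u t h
        - ((F - (b1 M * F + b2 M * F + b3 M * F)) + (u2 - (b2 M * K1 + b3 M * L1)) * h
           + (u3 - (b2 M * K2 + b3 M * L2)) * h^2 + (u4 - (b2 M * K3 + b3 M * L3)) * h^3)"
      unfolding local_truncation_error_def increment_def stage1_def E2_def E3_def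
      by (simp add: algebra_simps)
    then show ?thesis unfolding T0 T1 T2 T3 by simp
  qed
  then have "\<forall>\<^sub>F h in at 0. 1 / h * E0 h - b2 M * E2 h - b3 M * E3 h
      = local_truncation_error M f u t h - error_coeff M / 24 * h^3"
    by (auto simp: eventually_at intro!: exI[of _ 1])
  from landau_o.big.in_cong[OF this] O show ?thesis by simp
qed

section \<open>The order of the method\<close>

lemma order_3:
  assumes M: "order3_conditions M"
  shows "has_order_at M f u t 3"
proof -
  have "(\<lambda>h. local_truncation_error M f u t h - error_coeff M / 24 * h^3) \<in> O[at 0](\<lambda>h. h ^ 3)"
    by (rule landau_o.big_trans[OF truncation_error_expansion[OF M] bigo_power_mono]) simp
  moreover have "(\<lambda>h. h ^ 3 * (error_coeff M / 24)) \<in> O[at 0](\<lambda>h. h ^ 3)"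
    by (rule bigo_power_times) (rule tendsto_const)
  ultimately have "(\<lambda>h. (local_truncation_error M f u t h - error_coeff M / 24 * h^3)
      + h ^ 3 * (error_coeff M / 24)) \<in> O[at 0](\<lambda>h. h ^ 3)"
    by (rule sum_in_bigo(1))
  then show ?thesis by (simp add: has_order_at_def mult.commute)
qed

lemma order_4:
  assumes "order3_conditions M" "error_coeff M = 0"
  shows "has_order_at M f u t 4"
  using truncation_error_expansion[OF assms(1)] assms(2) by (simp add: has_order_at_def)

end

theorem mainTheorem2:
  fixes f :: "real \<Rightarrow> real \<Rightarrow> real" and u :: "real \<Rightarrow> real" and t :: real
    and S :: "(real \<times> real) set" and M :: rbf_rk3
    and U U2 F ft fu ftt ftu fuu fttt fttu ftuu fuuu :: real
  assumes smooth: "open S" "(t, u t) \<in> S" "Ck_on 4 f S"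
    and solution: "\<forall>\<^sub>F s in nhds t. (u has_real_derivative f s (u s)) (at s)"
    and U: "U = u t" and U2: "U2 = deriv (deriv u) t" and F: "F = f t U"
    and ft: "ft = pd_t f t U" and fu: "fu = pd_u f t U"
    and ftt: "ftt = pd_t (pd_t f) t U" and ftu: "ftu = pd_u (pd_t f) t U"
    and fuu: "fuu = pd_u (pd_u f) t U"
    and fttt: "fttt = pd_t (pd_t (pd_t f)) t U" and fttu: "fttu = pd_u (pd_t (pd_t f)) t U"
    and ftuu: "ftuu = pd_u (pd_u (pd_t f)) t U" and fuuu: "fuuu = pd_u (pd_u (pd_u f)) t U"
  shows
    "(b1 M + b2 M + b3 M = 1 \<and> a21 M = c2 M \<and> a31 M + a32 M = c3 M \<and>
      b2 M * c2 M + b3 M * c3 M = 1/2 \<and> b2 M * (c2 M)^2 + b3 M * (c3 M)^2 = 1/3 \<and>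
      a32 M * b3 M * c2 M = 1/6 \<and>
      b2 M * (c2 M)^2 * eps2sq M + b3 M * (c3 M)^2 * eps3sq M = 0
      \<longrightarrow> has_order_at M f u t 3)
   \<and>
     (a21 M = 1/2 \<and> c2 M = 1/2 \<and> a31 M = - 1 \<and> a32 M = 2 \<and> c3 M = 1 \<and>
      b1 M = 1/6 \<and> b2 M = 2/3 \<and> b3 M = 1/6 \<and>
      2 * U \<noteq> 0 \<and>
      eps2sq M = - (U2 / (2 * U)) \<and>
      eps3sq M = - eps2sq M
      \<longrightarrow> has_order_at M f u t 4)
   \<and>
     (a21 M = (15 - sqrt 33) / 24 \<and> c2 M = (15 - sqrt 33) / 24 \<and>
      a31 M = - ((147 + 29 * sqrt 33) / 768) \<and> a32 M = (627 + 61 * sqrt 33) / 768 \<and>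
      c3 M = (15 + sqrt 33) / 24 \<and>
      b1 M = 1/8 \<and> b2 M = (77 + 3 * sqrt 33) / 176 \<and> b3 M = (77 - 3 * sqrt 33) / 176 \<and>
      2 * (2 * (3 - sqrt 33) * (ftu + fuu * F) + (15 - sqrt 33) * fu^2) * U \<noteq> 0 \<and>
      eps2sq M =
        (- 2 * (3 - sqrt 33) * (ftu + fuu * F) * ft + (3 - sqrt 33) * (ftt - fuu * F^2) * fu
          - 12 * fu^2 * U2)
        / (2 * (2 * (3 - sqrt 33) * (ftu + fuu * F) + (15 - sqrt 33) * fu^2) * U) \<and>
      eps3sq M = - ((7 - sqrt 33) / 4) * eps2sq M
      \<longrightarrow> has_order_at M f u t 4)
   \<and>
     (a21 M = (15 + sqrt 33) / 24 \<and> c2 M = (15 + sqrt 33) / 24 \<and>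
      a31 M = (- 147 + 29 * sqrt 33) / 768 \<and> a32 M = (627 - 61 * sqrt 33) / 768 \<and>
      c3 M = (15 - sqrt 33) / 24 \<and>
      b1 M = 1/8 \<and> b2 M = (77 - 3 * sqrt 33) / 176 \<and> b3 M = (77 + 3 * sqrt 33) / 176 \<and>
      2 * (2 * (3 + sqrt 33) * (ftu + fuu * F) + (15 + sqrt 33) * fu^2) * U \<noteq> 0 \<and>
      eps2sq M =
        (- 2 * (3 + sqrt 33) * (ftu + fuu * F) * ft + (3 + sqrt 33) * (ftt - fuu * F^2) * fu
          - 12 * fu^2 * U2)
        / (2 * (2 * (3 + sqrt 33) * (ftu + fuu * F) + (15 + sqrt 33) * fu^2) * U) \<and>
      eps3sq M = - ((7 + sqrt 33) / 4) * eps2sq M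
      \<longrightarrow> has_order_at M f u t 4)
   \<and>
     (a21 M = 1/3 \<and> c2 M = 1/3 \<and> a31 M = - (5/12) \<and> a32 M = 5/4 \<and> c3 M = 5/6 \<and>
      b1 M = 1/10 \<and> b2 M = 1/2 \<and> b3 M = 2/5 \<and>
      2 * (2 * fu^2 - ftu - fuu * F) * U \<noteq> 0 \<and>
      eps2sq M =
        ((ftu + fuu * F) * ft - (ftt + ftu * F) * fu - 3 * fu^2 * U2)
        / (2 * (2 * fu^2 - ftu - fuu * F) * U) \<and>
      eps3sq M = - (1/5) * eps2sq M
      \<longrightarrow> has_order_at M f u t 4)
   \<and>
     (a21 M = 1 \<and> c2 M = 1 \<and> a31 M = 1/4 \<and> a32 M = 1/4 \<and> c3 M = 1/2 \<and>
      b1 M = 1/6 \<and> b2 M = 1/6 \<and> b3 M = 2/3 \<and>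
      2 * (2 * fu^2 + ftu + fuu * F) * U \<noteq> 0 \<and>
      eps2sq M =
        (- (ftu + fuu * F) * ft + (ftt + ftu * F) * fu - fu^2 * U2)
        / (2 * (2 * fu^2 + ftu + fuu * F) * U) \<and>
      eps3sq M = - eps2sq M
      \<longrightarrow> has_order_at M f u t 4)
   \<and>
     (a21 M = 1/2 \<and> c2 M = 1/2 \<and> a31 M = 0 \<and> a32 M = 3/4 \<and> c3 M = 3/4 \<and>
      b1 M = 2/9 \<and> b2 M = 1/3 \<and> b3 M = 4/9 \<and>
      6 * (4 * fu^2 - ftu - fuu * F) * U \<noteq> 0 \<and>
      eps2sq M =
        - ((fttt + fuuu * F^3 + 3 * (fttu + ftuu * F) * F + 12 * fu^2 * U2)
           / (6 * (4 * fu^2 - ftu - fuu * F) * U)) \<and>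
      eps3sq M = - (1/3) * eps2sq M
      \<longrightarrow> has_order_at M f u t 4)"
proof -
  interpret smooth_solution f S t u
    using smooth solution by unfold_locales auto
  have U2': "U2 = ft + fu * F"
    using second_derivative by (simp add: U2 ft fu F U)
  have err: "error_coeff M =
     (fttt + 3 * fttu * F + 3 * ftuu * F^2 + fuuu * F^3)
         * (1 - 4 * (b2 M * (c2 M)^3 + b3 M * (c3 M)^3))
     + (ftu + fuu * F) * U2 * (3 - 4 * c3 M)
     + fu * (ftt + 2 * ftu * F + fuu * F^2) * (1 - 2 * c2 M)
     + fu^2 * U2
     + 4 * U * (6 * (b2 M * (c2 M)^3 * eps2sq M + b3 M * (c3 M)^3 * eps3sq M) * (ftu + fuu * F)
         + c2 M * eps2sq M * fu^2)" for M
    unfolding error_coeff_def U2' by (simp add: F ft fu ftt ftu fuu fttt fttu ftuu fuuu U)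
  \<comment> \<open>Cases II(a) and II(b) are conjugate: they are obtained from the same data by taking \<open>s\<close> to be
    either square root of \<open>33\<close>.\<close>
  have case_II: "has_order_at M f u t 4"
    if s: "s * s = 33"
      and M: "a21 M = (15 - s) / 24" "c2 M = (15 - s) / 24"
        "a31 M = - ((147 + 29 * s) / 768)" "a32 M = (627 + 61 * s) / 768" "c3 M = (15 + s) / 24"
        "b1 M = 1/8" "b2 M = (77 + 3 * s) / 176" "b3 M = (77 - 3 * s) / 176"
        "eps3sq M = - ((7 - s) / 4) * eps2sq M"
      and den: "2 * (2 * (3 - s) * (ftu + fuu * F) + (15 - s) * fu^2) * U \<noteq> 0"
      and eps: "eps2sq M =
        (- 2 * (3 - s) * (ftu + fuu * F) * ft + (3 - s) * (ftt - fuu * F^2) * fu - 12 * fu^2 * U2)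
        / (2 * (2 * (3 - s) * (ftu + fuu * F) + (15 - s) * fu^2) * U)" for s :: real
  proof -
    have s': "s * (s * x) = 33 * x" for x
      using s by (simp flip: mult.assoc)
    note norm = s s' field_simps power2_eq_square power3_eq_cube
    have e: "2 * (2 * (3 - s) * (ftu + fuu * F) + (15 - s) * fu^2) * U * eps2sq M
        = - 2 * (3 - s) * (ftu + fuu * F) * ft + (3 - s) * (ftt - fuu * F^2) * fu - 12 * fu^2 * U2"
      unfolding eps using den by simp
    have cubes: "b2 M * (c2 M)^3 + b3 M * (c3 M)^3 = 1/4"
      by (simp add: M norm)
    have shapes: "b2 M * (c2 M)^3 * eps2sq M + b3 M * (c3 M)^3 * eps3sq M = (3 - s) / 72 * eps2sq M"
      by (simp add: M norm)
    have "12 * error_coeff M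
        = 2 * (2 * (3 - s) * (ftu + fuu * F) + (15 - s) * fu^2) * U * eps2sq M
          - (- 2 * (3 - s) * (ftu + fuu * F) * ft + (3 - s) * (ftt - fuu * F^2) * fu - 12 * fu^2 * U2)"
      unfolding err cubes shapes by (simp add: M(2,5) U2' field_simps power2_eq_square power3_eq_cube)
    then have "error_coeff M = 0" unfolding e by simp
    moreover have "order3_conditions M"
      unfolding order3_conditions_def by (simp add: M norm)
    ultimately show ?thesis by (rule order_4[rotated])
  qed
  show ?thesis
  proof (intro conjI impI, goal_cases)
    case 1
    then show ?case by (intro order_3) (simp add: order3_conditions_def)
  next
    case 2
    then have M: "a21 M = 1/2" "c2 M = 1/2" "a31 M = - 1" "a32 M = 2" "c3 M = 1"
      "b1 M = 1/6" "b2 M = 2/3" "b3 M = 1/6" "eps3sq M = - eps2sq M" and U0: "U \<noteq> 0"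
      and e: "2 * U * eps2sq M = - U2" by simp_all
    have "error_coeff M = (fu^2 - (ftu + fuu * F)) * (2 * U * eps2sq M + U2)"
      by (simp add: err M field_simps power2_eq_square power3_eq_cube)
    then show ?case
      using e by (intro order_4) (simp_all add: order3_conditions_def M power2_eq_square)
  next
    case 3
    then show ?case
      using case_II[of "sqrt 33"] by simp
  next
    case 4
    then have a31: "a31 M = - ((147 - 29 * sqrt 33) / 768)" by (simp add: field_simps)
    from 4 show ?case
      using case_II[of "- sqrt 33"] a31 by simp
  next
    case 5
    then have M: "a21 M = 1/3" "c2 M = 1/3" "a31 M = - (5/12)" "a32 M = 5/4" "c3 M = 5/6"
      "b1 M = 1/10" "b2 M = 1/2" "b3 M = 2/5" "eps3sq M = - (1/5) * eps2sq M" by simp_all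
    have e: "2 * (2 * fu^2 - ftu - fuu * F) * U * eps2sq M
        = (ftu + fuu * F) * ft - (ftt + ftu * F) * fu - 3 * fu^2 * U2"
      using 5 by simp
    have "3 * error_coeff M = 2 * (2 * fu^2 - ftu - fuu * F) * U * eps2sq M
        - ((ftu + fuu * F) * ft - (ftt + ftu * F) * fu - 3 * fu^2 * U2)"
      by (simp add: err M U2' field_simps power2_eq_square power3_eq_cube)
    then show ?case
      unfolding e by (intro order_4) (simp_all add: order3_conditions_def M power2_eq_square)
  next
    case 6
    then have M: "a21 M = 1" "c2 M = 1" "a31 M = 1/4" "a32 M = 1/4" "c3 M = 1/2"
      "b1 M = 1/6" "b2 M = 1/6" "b3 M = 2/3" "eps3sq M = - eps2sq M" by simp_all
    have e: "2 * (2 * fu^2 + ftu + fuu * F) * U * eps2sq M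
        = - (ftu + fuu * F) * ft + (ftt + ftu * F) * fu - fu^2 * U2"
      using 6 by simp
    have "error_coeff M = 2 * (2 * fu^2 + ftu + fuu * F) * U * eps2sq M
        - (- (ftu + fuu * F) * ft + (ftt + ftu * F) * fu - fu^2 * U2)"
      by (simp add: err M U2' field_simps power2_eq_square power3_eq_cube)
    then show ?case
      unfolding e by (intro order_4) (simp_all add: order3_conditions_def M power2_eq_square)
  next
    case 7
    then have M: "a21 M = 1/2" "c2 M = 1/2" "a31 M = 0" "a32 M = 3/4" "c3 M = 3/4"
      "b1 M = 2/9" "b2 M = 1/3" "b3 M = 4/9" "eps3sq M = - (1/3) * eps2sq M" by simp_all
    have e: "6 * (4 * fu^2 - ftu - fuu * F) * U * eps2sq M
        = - (fttt + fuuu * F^3 + 3 * (fttu + ftuu * F) * F + 12 * fu^2 * U2)"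
      using 7 by simp
    have "12 * error_coeff M = 6 * (4 * fu^2 - ftu - fuu * F) * U * eps2sq M
        + (fttt + fuuu * F^3 + 3 * (fttu + ftuu * F) * F + 12 * fu^2 * U2)"
      by (simp add: err M U2' field_simps power2_eq_square power3_eq_cube)
    then show ?case
      unfolding e by (intro order_4) (simp_all add: order3_conditions_def M power2_eq_square)
  qed
qed

end
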